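(* Let $(g,\theta,\mathfrak u)$ be an adapted LCP structure on a Lie algebra $\mathfrak g$. Then $\mathfrak u$ is an abelian ideal contained in $\mathfrak g'=[\mathfrak g,\mathfrak g]$, the orthogonal complement $\mathfrak u^\perp$ is a Lie subalgebra, and for every $x\in\mathfrak g$ one has $$\mathrm{ad}_x|_{\mathfrak u}=\nabla^\theta_x|_{\mathfrak u},\qquad \theta(x)=\frac{1}{\dim\mathfrak u}\,\mathrm{tr}(\mathrm{ad}_x|_{\mathfrak u}).$$
   Context: All Lie algebras are real and finite-dimensional. Let $\mathfrak g$ be a Lie algebra with an inner product $g$. For $x\in\mathfrak g$, $\nabla^g_x\in\mathfrak{so}(\mathfrak g)$ is given by $g(\nabla^g_xy,z)=\frac12\big(g([x,y],z)-g([x,z],y)-g([y,z],x)\big)$. For $\theta\in\mathfrak g^*$ with $g$-dual vector $\theta^\sharp$, set $\nabla^\theta_xy:=\nabla^g_xy+\theta(x)y+\theta(y)x-g(x,y)\theta^\sharp$. A 1-form $\theta\in\mathfrak g^*$ is closed if it vanishes on $\mathfrak g'=[\mathfrak g,\mathfrak g]$. A subspace $\mathfrak u\subset\mathfrak g$ is $\nabla^\theta$-flat if $\nabla^\theta_x\mathfrak u\subset\mathfrak u$ for all $x\in\mathfrak g$ and $x\mapsto\nabla^\theta_x|_{\mathfrak u}$ is a Lie algebra representation $\mathfrak g\to\mathfrak{gl}(\mathfrak u)$. An LCP structure on $\mathfrak g$ is a triple $(g,\theta,\mathfrak u)$ with $g$ an inner product, $\theta\ne0$ a closed 1-form and $\mathfrak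 u\neq0$ a $\nabla^\theta$-flat subspace. It is adapted if $\theta|_{\mathfrak u}=0$. *)

theory Defs
  imports "HOL-Analysis.Analysis"
begin

section \<open>Lie algebras\<close>

text \<open>
  The Lie algebra is the whole type \<open>'a\<close>, a bare real vector space without a preferred norm or
  inner product, equipped with a bracket \<open>br\<close>.
\<close>

definition lie_algebra :: "('a::real_vector \<Rightarrow> 'a \<Rightarrow> 'a) \<Rightarrow> bool" where
  "lie_algebra br \<longleftrightarrow>
     bilinear br \<and> (\<forall>x. br x x = 0) \<and>
     (\<forall>x y z. br x (br y z) + br y (br z x) + br z (br x y) = 0)"

definition finite_dimensional :: "'a::real_vector itself \<Rightarrow> bool" where
  "finite_dimensional _ \<longleftrightarrow> (\<exists>B::'a set. finite B \<and> span B = UNIV)"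

definition derived_algebra :: "('a::real_vector \<Rightarrow> 'a \<Rightarrow> 'a) \<Rightarrow> 'a set" where
  "derived_algebra br = span {br x y | x y. True}"

definition lie_subalgebra :: "('a::real_vector \<Rightarrow> 'a \<Rightarrow> 'a) \<Rightarrow> 'a set \<Rightarrow> bool" where
  "lie_subalgebra br h \<longleftrightarrow> subspace h \<and> (\<forall>x\<in>h. \<forall>y\<in>h. br x y \<in> h)"

definition lie_ideal :: "('a::real_vector \<Rightarrow> 'a \<Rightarrow> 'a) \<Rightarrow> 'a set \<Rightarrow> bool" where
  "lie_ideal br h \<longleftrightarrow> subspace h \<and> (\<forall>x. \<forall>y\<in>h. br x y \<in> h)"

definition abelian_on :: "('a::real_vector \<Rightarrow> 'a \<Rightarrow> 'a) \<Rightarrow> 'a set \<Rightarrow> bool" where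
  "abelian_on br h \<longleftrightarrow> (\<forall>x\<in>h. \<forall>y\<in>h. br x y = 0)"

text \<open>
  The restrictions \<open>\<rho> x|\<^sub>u\<close> form a representation on the subspace \<open>u\<close>; only the values of
  \<open>\<rho> x\<close> on \<open>u\<close> are constrained.
\<close>

definition lie_representation_on ::
    "('a::real_vector \<Rightarrow> 'a \<Rightarrow> 'a) \<Rightarrow> ('b::real_vector) set \<Rightarrow> ('a \<Rightarrow> 'b \<Rightarrow> 'b) \<Rightarrow> bool" where
  "lie_representation_on br u \<rho> \<longleftrightarrow>
     (\<forall>x. \<forall>v\<in>u. \<rho> x v \<in> u) \<and>
     (\<forall>x. \<forall>v\<in>u. \<forall>w\<in>u. \<rho> x (v + w) = \<rho> x v + \<rho> x w) \<and>
     (\<forall>x c. \<forall>v\<in>u. \<rho> x (c *\<^sub>R v) = c *\<^sub>R \<rho> x v) \<and>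
     (\<forall>v\<in>u. linear (\<lambda>x. \<rho> x v)) \<and>
     (\<forall>x y. \<forall>v\<in>u. \<rho> (br x y) v = \<rho> x (\<rho> y v) - \<rho> y (\<rho> x v))"

section \<open>Trace of an endomorphism of a subspace\<close>

definition trace_on :: "'a::real_vector set \<Rightarrow> ('a \<Rightarrow> 'a) \<Rightarrow> real" where
  "trace_on u f =
     (let B = (SOME B. independent B \<and> span B = u) in \<Sum>b\<in>B. representation B (f b) b)"

lemma trace_sum_basis_indep:
  assumes B: "independent B" "finite B" "span B = u"
    and C: "independent C" "finite C" "span C = u"
    and f: "linear f" "f ` u \<subseteq> u"
  shows "(\<Sum>b\<in>B. representation B (f b) b) = (\<Sum>c\<in>C. representation C (f c) c)"
proof -
  have fu: "f x \<in> u" if "x \<in> u" for x using f that by auto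
  have Bu: "b \<in> u" if "b \<in> B" for b using B that span_base by blast
  have Cu: "c \<in> u" if "c \<in> C" for c using C that span_base by blast
  have su: "r *\<^sub>R x \<in> u" if "x \<in> u" for r x using B(3) that real_vector.span_scale by blast
  have 1: "representation B (f b) b
      = (\<Sum>c\<in>C. representation C b c * representation B (f c) b)" if b: "b \<in> B" for b
  proof -
    have "b = (\<Sum>c\<in>C. representation C b c *\<^sub>R c)"
      using real_vector.sum_representation_eq[OF C(1) _ C(2) subset_refl] C(3) Bu[OF b] by simp
    then have "f b = f (\<Sum>c\<in>C. representation C b c *\<^sub>R c)" by (rule arg_cong)
    also have "\<dots> = (\<Sum>c\<in>C. representation C b c *\<^sub>R f c)"
      by (simp add: linear_sum[OF f(1)] linear_scale[OF f(1)])
    finally have "f b = (\<Sum>c\<in>C. representation C b c *\<^sub>R f c)" .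
    then have "representation B (f b) b
        = representation B (\<Sum>c\<in>C. representation C b c *\<^sub>R f c) b"
      by (rule arg_cong[where f = "\<lambda>v. representation B v b"])
    also have "\<dots> = (\<Sum>c\<in>C. representation B (representation C b c *\<^sub>R f c) b)"
      by (subst real_vector.representation_sum[OF B(1)]) (auto simp: B(3) fu Cu su)
    also have "\<dots> = (\<Sum>c\<in>C. representation C b c * representation B (f c) b)"
      using real_vector.representation_scale[OF B(1)] B(3) fu Cu by (intro sum.cong) auto
    finally show ?thesis .
  qed
  have 2: "representation C (f c) c
      = (\<Sum>b\<in>B. representation B (f c) b * representation C b c)" if c: "c \<in> C" for c
  proof -
    have "f c = (\<Sum>b\<in>B. representation B (f c) b *\<^sub>R b)"
      using real_vector.sum_representation_eq[OF B(1) _ B(2) subset_refl] B(3) fu[OF Cu[OF c]]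
      by simp
    then have "representation C (f c) c
        = representation C (\<Sum>b\<in>B. representation B (f c) b *\<^sub>R b) c"
      by (rule arg_cong[where f = "\<lambda>v. representation C v c"])
    also have "\<dots> = (\<Sum>b\<in>B. representation C (representation B (f c) b *\<^sub>R b) c)"
      by (subst real_vector.representation_sum[OF C(1)]) (auto simp: C(3) Bu su)
    also have "\<dots> = (\<Sum>b\<in>B. representation B (f c) b * representation C b c)"
      using real_vector.representation_scale[OF C(1)] C(3) Bu by (intro sum.cong) auto
    finally show ?thesis .
  qed
  have "(\<Sum>b\<in>B. representation B (f b) b)
      = (\<Sum>b\<in>B. \<Sum>c\<in>C. representation C b c * representation B (f c) b)"
    using 1 by simp
  also have "\<dots> = (\<Sum>c\<in>C. \<Sum>b\<in>B. representation B (f c) b * representation C b c)"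
    by (subst sum.swap) (simp add: mult.commute)
  also have "\<dots> = (\<Sum>c\<in>C. representation C (f c) c)" using 2 by simp
  finally show ?thesis .
qed

lemma finite_independent:
  assumes "finite_dimensional TYPE('a::real_vector)" and "independent (B::'a set)"
  shows "finite B"
proof -
  obtain T :: "'a set" where "finite T" "span T = UNIV"
    using assms(1) unfolding finite_dimensional_def by blast
  then show ?thesis
    using real_vector.independent_span_bound[of T B] assms(2) by simp
qed

lemma trace_on_eq:
  fixes C :: "'a::real_vector set"
  assumes "finite_dimensional TYPE('a)" and "independent C" and "span C = u"
    and "linear f" and "f ` u \<subseteq> u"
  shows "trace_on u f = (\<Sum>c\<in>C. representation C (f c) c)"
proof -
  define B where "B = (SOME B. independent B \<and> span B = u)"
  have B: "independent B \<and> span B = u"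
    unfolding B_def by (rule someI[where x = C]) (use assms(2,3) in blast)
  have "trace_on u f = (\<Sum>b\<in>B. representation B (f b) b)"
    by (simp only: trace_on_def B_def Let_def)
  also have "\<dots> = (\<Sum>c\<in>C. representation C (f c) c)"
    by (rule trace_sum_basis_indep[where u = u])
      (use B assms finite_independent[OF assms(1)] in blast)+
  finally show ?thesis .
qed

section \<open>Inner products\<close>

definition inner_product :: "('a::real_vector \<Rightarrow> 'a \<Rightarrow> real) \<Rightarrow> bool" where
  "inner_product g \<longleftrightarrow> bilinear g \<and> (\<forall>x y. g x y = g y x) \<and> (\<forall>x. x \<noteq> 0 \<longrightarrow> g x x > 0)"

definition orth_compl :: "('a::real_vector \<Rightarrow> 'a \<Rightarrow> real) \<Rightarrow> 'a set \<Rightarrow> 'a set" where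
  "orth_compl g u = {x. \<forall>y\<in>u. g x y = 0}"

text \<open>The \<open>g\<close>-dual vector \<open>\<phi>\<^sup>\<sharp>\<close> of a linear form \<open>\<phi>\<close>.\<close>

definition sharp :: "('a::real_vector \<Rightarrow> 'a \<Rightarrow> real) \<Rightarrow> ('a \<Rightarrow> real) \<Rightarrow> 'a" where
  "sharp g \<phi> = (THE v. \<forall>z. g v z = \<phi> z)"

lemma inner_product_representative:
  fixes g :: "'a::real_vector \<Rightarrow> 'a \<Rightarrow> real"
  assumes fd: "finite_dimensional TYPE('a)" and g: "inner_product g" and lin: "linear \<phi>"
  shows "\<exists>!v. \<forall>z. g v z = \<phi> z"
proof -
  obtain B :: "'a set" where B: "independent B" "span B = UNIV"
    using real_vector.basis_exists[of UNIV] by (metis top.extremum_uniqueI)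
  have finB: "finite B" using fd B finite_independent by blast
  interpret F: finite_dimensional_vector_space "scaleR :: real \<Rightarrow> 'a \<Rightarrow> 'a" B
    by unfold_locales (use finB B in
      \<open>auto simp: dependent_raw_def[symmetric] span_raw_def[symmetric]\<close>)
  have bil: "bilinear g" and pos: "\<And>x. x \<noteq> 0 \<Longrightarrow> g x x > 0"
    using g by (auto simp: inner_product_def)
  have l1: "linear (g v)" for v using bil by (simp add: bilinear_def)
  have l2: "linear (\<lambda>v. g v z)" for z using bil by (simp add: bilinear_def)
  define T where "T v = (\<Sum>b\<in>B. g v b *\<^sub>R b)" for v
  have linT: "linear T"
    by (rule linearI) (simp_all add: T_def bilinear_ladd[OF bil] bilinear_lmul[OF bil]
        scaleR_left.add sum.distrib scaleR_sum_right)
  have ext: "g v z = \<psi> z" if "linear \<psi>" "\<And>b. b \<in> B \<Longrightarrow> g v b = \<psi> b" for v z \<psi>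
    using real_vector.linear_eq_on_span[of "g v" \<psi> B z] l1 that B by auto
  have coeff: "a b = c b" if "(\<Sum>b\<in>B. a b *\<^sub>R b) = (\<Sum>b\<in>B. c b *\<^sub>R b)" "b \<in> B"
    for a c :: "'a \<Rightarrow> real" and b
  proof -
    have "(\<Sum>b\<in>B. (a b - c b) *\<^sub>R b) = 0"
      using that(1) by (simp add: scaleR_left_diff_distrib sum_subtractf)
    then have "a b - c b = 0"
      by (rule real_vector.independentD[OF B(1) finB subset_refl _ that(2)])
    then show ?thesis by simp
  qed
  have "inj T"
    unfolding linear_injective_0[OF linT]
  proof (intro allI impI)
    fix v assume "T v = 0"
    then have "g v b = 0" if "b \<in> B" for b
      using coeff[of "g v" "\<lambda>_. 0" b] that by (simp add: T_def)
    then have "g v v = 0" using ext[of "\<lambda>_. 0" v v] by (simp add: linear_zero)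
    then show "v = 0" using pos[of v] by fastforce
  qed
  moreover have "Vector_Spaces.linear scaleR scaleR T"
    using linT by (simp add: linear_def)
  ultimately have "surj T" using F.linear_inj_imp_surj by blast
  then obtain v where "T v = (\<Sum>b\<in>B. \<phi> b *\<^sub>R b)" by (metis surjD)
  then have "g v b = \<phi> b" if "b \<in> B" for b
    using coeff[of "g v" \<phi> b] that by (simp add: T_def)
  then have ex: "\<forall>z. g v z = \<phi> z" using ext lin by blast
  moreover have "w = v" if "\<forall>z. g w z = \<phi> z" for w
  proof -
    have "g (w - v) (w - v) = 0" using that ex by (simp add: bilinear_lsub[OF bil])
    then show "w = v" using pos[of "w - v"] by fastforce
  qed
  ultimately show ?thesis by blast
qed

lemma sharp_eq:
  fixes g :: "'a::real_vector \<Rightarrow> 'a \<Rightarrow> real"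
  assumes "finite_dimensional TYPE('a)" and "inner_product g" and "linear \<phi>"
  shows "g (sharp g \<phi>) z = \<phi> z"
  using theI'[OF inner_product_representative[OF assms]] by (simp add: sharp_def)

section \<open>The Levi-Civita and Weyl connections\<close>

definition levi_civita ::
    "('a::real_vector \<Rightarrow> 'a \<Rightarrow> 'a) \<Rightarrow> ('a \<Rightarrow> 'a \<Rightarrow> real) \<Rightarrow> 'a \<Rightarrow> 'a \<Rightarrow> 'a" where
  "levi_civita br g x y =
     (THE v. \<forall>z. g v z = 1/2 * (g (br x y) z - g (br x z) y - g (br y z) x))"

lemma levi_civita_eq:
  fixes g :: "'a::real_vector \<Rightarrow> 'a \<Rightarrow> real"
  assumes "finite_dimensional TYPE('a)" and "inner_product g" and "bilinear br"
  shows "g (levi_civita br g x y) z = 1/2 * (g (br x y) z - g (br x z) y - g (br y z) x)"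
proof -
  have bil: "bilinear g" using assms by (simp add: inner_product_def)
  have "linear (\<lambda>z. 1/2 * (g (br x y) z - g (br x z) y - g (br y z) x))"
    by (rule linearI)
      (simp_all add: bilinear_radd[OF bil] bilinear_rmul[OF bil] bilinear_ladd[OF bil]
        bilinear_lmul[OF bil] bilinear_radd[OF assms(3)] bilinear_rmul[OF assms(3)] algebra_simps)
  from theI'[OF inner_product_representative[OF assms(1,2) this]] show ?thesis
    by (simp add: levi_civita_def)
qed

definition weyl ::
    "('a::real_vector \<Rightarrow> 'a \<Rightarrow> 'a) \<Rightarrow> ('a \<Rightarrow> 'a \<Rightarrow> real) \<Rightarrow> ('a \<Rightarrow> real) \<Rightarrow> 'a \<Rightarrow> 'a \<Rightarrow> 'a" where
  "weyl br g \<theta> x y =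
     levi_civita br g x y + \<theta> x *\<^sub>R y + \<theta> y *\<^sub>R x - g x y *\<^sub>R sharp g \<theta>"

section \<open>LCP structures\<close>

definition closed_form :: "('a::real_vector \<Rightarrow> 'a \<Rightarrow> 'a) \<Rightarrow> ('a \<Rightarrow> real) \<Rightarrow> bool" where
  "closed_form br \<theta> \<longleftrightarrow> linear \<theta> \<and> (\<forall>x\<in>derived_algebra br. \<theta> x = 0)"

definition weyl_flat ::
    "('a::real_vector \<Rightarrow> 'a \<Rightarrow> 'a) \<Rightarrow> ('a \<Rightarrow> 'a \<Rightarrow> real) \<Rightarrow> ('a \<Rightarrow> real) \<Rightarrow> 'a set \<Rightarrow> bool" where
  "weyl_flat br g \<theta> u \<longleftrightarrow>
     subspace u \<and> (\<forall>x. weyl br g \<theta> x ` u \<subseteq> u) \<and> lie_representation_on br u (weyl br g \<theta>)"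

definition lcp_structure ::
    "('a::real_vector \<Rightarrow> 'a \<Rightarrow> 'a) \<Rightarrow> ('a \<Rightarrow> 'a \<Rightarrow> real) \<Rightarrow> ('a \<Rightarrow> real) \<Rightarrow> 'a set \<Rightarrow> bool" where
  "lcp_structure br g \<theta> u \<longleftrightarrow>
     inner_product g \<and> closed_form br \<theta> \<and> \<theta> \<noteq> (\<lambda>_. 0) \<and> weyl_flat br g \<theta> u \<and> u \<noteq> {0}"

definition adapted_lcp_structure ::
    "('a::real_vector \<Rightarrow> 'a \<Rightarrow> 'a) \<Rightarrow> ('a \<Rightarrow> 'a \<Rightarrow> real) \<Rightarrow> ('a \<Rightarrow> real) \<Rightarrow> 'a set \<Rightarrow> bool" where
  "adapted_lcp_structure br g \<theta> u \<longleftrightarrow> lcp_structure br g \<theta> u \<and> (\<forall>v\<in>u. \<theta> v = 0)"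

end

theory Submission
  imports Defs
begin

text \<open>
  Write \<open>D\<close> for the Weyl connection. It is torsion-free and \<open>D\<^sub>x - \<theta>(x)\<close> is skew; as \<open>\<theta>\<close> is closed,
  its curvature \<open>R\<close> takes values in skew endomorphisms. For \<open>v \<in> u\<close>, flatness of \<open>u\<close> and the Bianchi
  identity make \<open>g(R(v,x)y,z)\<close> symmetric in \<open>x,y\<close> and skew in \<open>y,z\<close>, so \<open>R(v,\<cdot>) = 0\<close>.
  For the dual vector \<open>\<xi>\<close> of \<open>\<theta>\<close> one has \<open>D\<^sub>v \<xi> = 0\<close>, whence \<open>[\<xi>,v] = D\<^sub>\<xi> v\<close> and
  \<open>D\<^bsub>D\<^sub>\<xi> v\<^esub> = [D\<^sub>\<xi>, D\<^sub>v]\<close>. With \<open>A = D\<^sub>\<xi> - \<theta>(\<xi>)\<close>, this says that the trilinear map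
  \<open>\<phi>(v,y,z) = g(D\<^sub>v y,z)\<close> on \<open>u \<times> \<gg> \<times> \<gg>\<close> is an eigenvector, with eigenvalue \<open>-\<theta>(\<xi>) \<noteq> 0\<close>, of the
  action of the skew map \<open>A\<close> on trilinear maps. That action is itself skew, so \<open>\<phi> = 0\<close>, that is
  \<open>D\<^sub>v = 0\<close> for \<open>v \<in> u\<close>. Everything else follows from this.
\<close>

section \<open>Orthonormal families for an abstract inner product\<close>

definition orthonormal :: "('a::real_vector \<Rightarrow> 'a \<Rightarrow> real) \<Rightarrow> 'a set \<Rightarrow> bool" where
  "orthonormal g B \<longleftrightarrow> finite B \<and> (\<forall>b\<in>B. \<forall>c\<in>B. g b c = (if b = c then 1 else 0))"

locale inner_product_space =
  fixes g :: "'a::real_vector \<Rightarrow> 'a \<Rightarrow> real"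
  assumes inner_product: "inner_product g"
begin

lemma bil: "bilinear g"
  using inner_product by (simp add: inner_product_def)

lemmas g_simps =
  bilinear_ladd[OF bil] bilinear_radd[OF bil] bilinear_lmul[OF bil] bilinear_rmul[OF bil]
  bilinear_lsub[OF bil] bilinear_rsub[OF bil] bilinear_lneg[OF bil] bilinear_rneg[OF bil]
  bilinear_lzero[OF bil] bilinear_rzero[OF bil]

lemma g_commute: "g x y = g y x"
  using inner_product by (simp add: inner_product_def)

lemma g_self_eq_0_iff: "g x x = 0 \<longleftrightarrow> x = 0"
  using inner_product g_simps(9)[of 0] unfolding inner_product_def by force

lemma linear_g: "linear (\<lambda>x. g x z)"
  using bil by (simp add: bilinear_def)

lemma g_sum_left: "g (\<Sum>b\<in>B. c b *\<^sub>R f b) z = (\<Sum>b\<in>B. c b * g (f b) z)"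
  by (simp add: linear_sum[OF linear_g] g_simps)

lemma g_eqI:
  assumes "\<And>z. g x z = g y z"
  shows "x = y"
  using g_self_eq_0_iff[of "x - y"] assms by (simp add: g_simps)

lemma orthonormal_coeff:
  assumes "orthonormal g B" "b \<in> B"
  shows "g (\<Sum>a\<in>B. c a *\<^sub>R a) b = c b"
proof -
  have "g (\<Sum>a\<in>B. c a *\<^sub>R a) b = (\<Sum>a\<in>B. if a = b then c a else 0)"
    unfolding g_sum_left
    by (rule sum.cong) (use assms in \<open>auto simp: orthonormal_def\<close>)
  then show ?thesis using assms by (simp add: orthonormal_def)
qed

lemma orthonormal_independent:
  assumes "orthonormal g B"
  shows "independent B"
proof (rule independent_if_scalars_zero)
  show "finite B" using assms by (simp add: orthonormal_def)
  show "c b = 0" if "(\<Sum>a\<in>B. c a *\<^sub>R a) = 0" "b \<in> B" for c b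
    using orthonormal_coeff[OF assms that(2), of c] that(1) by (simp add: g_simps)
qed

lemma orthonormal_expansion:
  assumes "orthonormal g B" "x \<in> span B"
  shows "x = (\<Sum>b\<in>B. g x b *\<^sub>R b)"
proof -
  have "finite B" using assms by (simp add: orthonormal_def)
  then obtain c where c: "x = (\<Sum>b\<in>B. c b *\<^sub>R b)"
    using assms(2) by (auto simp: span_finite)
  then show ?thesis using orthonormal_coeff[OF assms(1), of _ c] by simp
qed

lemma representation_orthonormal:
  assumes B: "orthonormal g B" and "x \<in> span B" "b \<in> B"
  shows "representation B x b = g x b"
proof -
  have fin: "finite B" using B by (simp add: orthonormal_def)
  have "(\<Sum>a\<in>B. representation B x a *\<^sub>R a) = x"
    using real_vector.sum_representation_eq[OF orthonormal_independent[OF B] assms(2) fin] by simp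
  then show ?thesis using orthonormal_coeff[OF B assms(3), of "representation B x"] by simp
qed

section \<open>Gram-Schmidt orthonormalisation\<close>

lemma orthonormal_extend:
  assumes B: "orthonormal g B"
  shows "\<exists>C. orthonormal g C \<and> span C = span (insert a B)"
proof -
  \<comment> \<open>\<open>p\<close> is the orthogonal projection of \<open>a\<close> to
    \<open>span B\<close>; a nonzero remainder \<open>n\<close> is normalised and added to
    \<open>B\<close>.\<close>
  define p where "p = (\<Sum>b\<in>B. g a b *\<^sub>R b)"
  define n where "n = a - p"
  have p: "p \<in> span B" unfolding p_def by (intro span_sum span_scale span_base)
  have nB: "g n b = 0" if "b \<in> B" for b
    using orthonormal_coeff[OF B that] by (simp add: n_def p_def g_simps)
  show ?thesis
  proof (cases "n = 0")
    case True
    then have "a \<in> span B" using p by (simp add: n_def)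
    then show ?thesis using B span_redundant by metis
  next
    case False
    then have pos: "g n n > 0" using inner_product by (simp add: inner_product_def)
    define m where "m = (1 / sqrt (g n n)) *\<^sub>R n"
    have mm: "g m m = 1" using pos by (simp add: m_def g_simps)
    have mB: "g m b = 0" "g b m = 0" if "b \<in> B" for b
      using nB[OF that] g_commute[of b n] by (simp_all add: m_def g_simps)
    have "orthonormal g (insert m B)"
      using B mm mB by (auto simp: orthonormal_def)
    moreover have "span (insert m B) = span (insert a B)"
    proof
      have "m \<in> span (insert a B)"
        unfolding m_def n_def using p span_mono[of B "insert a B"]
        by (intro span_scale span_diff) (auto intro: span_base)
      then show "span (insert m B) \<subseteq> span (insert a B)"
        by (intro span_minimal) (auto intro: span_base)
      have "a = sqrt (g n n) *\<^sub>R m + p" using pos by (simp add: m_def n_def)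
      also have "\<dots> \<in> span (insert m B)"
        using p span_mono[of B "insert m B"]
        by (intro span_scale span_add) (auto intro: span_base)
      finally show "span (insert a B) \<subseteq> span (insert m B)"
        by (intro span_minimal) (auto intro: span_base)
    qed
    ultimately show ?thesis by blast
  qed
qed

lemma orthonormal_basis_of_span:
  assumes "finite S"
  shows "\<exists>B. orthonormal g B \<and> span B = span S"
  using assms
proof (induction S rule: finite_induct)
  case empty
  have "orthonormal g {}" by (simp add: orthonormal_def)
  then show ?case by blast
next
  case (insert a S)
  then obtain B where B: "orthonormal g B" "span B = span S" by blast
  have "span (insert a B) = span (insert a S)" using B(2) by (simp add: span_insert)
  then show ?case using orthonormal_extend[OF B(1), of a] by simp
qed

lemma orthonormal_basis_of_subspace:
  assumes "finite_dimensional TYPE('a)" "subspace u"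
  shows "\<exists>B. orthonormal g B \<and> span B = u"
proof -
  obtain S where S: "S \<subseteq> u" "independent S" "u \<subseteq> span S"
    using real_vector.basis_exists[of u] by metis
  then have "span S = u" using span_minimal[OF S(1) assms(2)] by blast
  then show ?thesis
    using orthonormal_basis_of_span[of S] finite_independent[OF assms(1) S(2)] by simp
qed

text \<open>Expanding \<open>T b\<close> in \<open>B\<close> contracts the skew matrix
  \<open>g (T b) c\<close> with the symmetric matrix \<open>h b * h c\<close>.\<close>

lemma sum_skew_eq_0:
  fixes h :: "'a \<Rightarrow> real"
  assumes B: "orthonormal g B" and h: "linear h"
    and T: "\<And>b. b \<in> B \<Longrightarrow> T b \<in> span B"
    and skew: "\<And>x y. g (T x) y = - g x (T y)"
  shows "(\<Sum>b\<in>B. h b * h (T b)) = 0"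
proof -
  let ?S = "\<Sum>b\<in>B. \<Sum>c\<in>B. h b * h c * g (T b) c"
  have hT: "h (T b) = (\<Sum>c\<in>B. g (T b) c * h c)" if "b \<in> B" for b
    using arg_cong[OF orthonormal_expansion[OF B T[OF that]], of h]
    by (simp add: linear_sum[OF h] linear_scale[OF h])
  have flip: "g (T b) c = - g (T c) b" for b c
    using skew[of b c] g_commute[of b "T c"] by simp
  have "?S = (\<Sum>c\<in>B. \<Sum>b\<in>B. h b * h c * g (T b) c)" by (rule sum.swap)
  also have "\<dots> = (\<Sum>c\<in>B. \<Sum>b\<in>B. - (h c * h b * g (T c) b))"
  proof (intro sum.cong refl)
    show "h b * h c * g (T b) c = - (h c * h b * g (T c) b)" for b c
      using flip[of b c] by simp
  qed
  also have "\<dots> = - ?S" by (simp add: sum_negf)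
  finally have "?S = 0" by simp
  moreover have "(\<Sum>b\<in>B. h b * h (T b)) = ?S"
    by (simp add: hT sum_distrib_left algebra_simps)
  ultimately show ?thesis by simp
qed

text \<open>
  The skew map \<open>A\<close> acts skew-symmetrically on trilinear maps, hence has no nonzero real eigenvalue.
\<close>

lemma trilinear_eigen_eq_0:
  fixes \<phi> :: "'a \<Rightarrow> 'a \<Rightarrow> 'a \<Rightarrow> real"
  assumes fd: "finite_dimensional TYPE('a)" and u: "subspace u"
    and l1: "\<And>y z. linear (\<lambda>v. \<phi> v y z)"
    and l2: "\<And>v z. linear (\<lambda>y. \<phi> v y z)"
    and l3: "\<And>v y. linear (\<lambda>z. \<phi> v y z)"
    and skew: "\<And>x y. g (A x) y = - g x (A y)"
    and Au: "\<And>v. v \<in> u \<Longrightarrow> A v \<in> u"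
    and "c \<noteq> 0"
    and eigen: "\<And>v y z. v \<in> u \<Longrightarrow> c * \<phi> v y z = - (\<phi> (A v) y z + \<phi> v (A y) z + \<phi> v y (A z))"
    and "v \<in> u"
  shows "\<phi> v y z = 0"
proof -
  obtain B where B: "orthonormal g B" "span B = u"
    using orthonormal_basis_of_subspace[OF fd u] by blast
  obtain C where C: "orthonormal g C" "span C = UNIV"
    using orthonormal_basis_of_subspace[OF fd subspace_UNIV] by blast
  have fin: "finite B" "finite C" using B C by (auto simp: orthonormal_def)
  have Bu: "b \<in> u" if "b \<in> B" for b using B(2) that by (auto intro: span_base)
  have 1: "(\<Sum>b\<in>B. \<phi> b e f * \<phi> (A b) e f) = 0" for e f
    by (rule sum_skew_eq_0[OF B(1) l1 _ skew]) (simp add: B Au Bu)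
  have 2: "(\<Sum>e\<in>C. \<phi> b e f * \<phi> b (A e) f) = 0" for b f
    by (rule sum_skew_eq_0[OF C(1) l2 _ skew]) (simp add: C)
  have 3: "(\<Sum>f\<in>C. \<phi> b e f * \<phi> b e (A f)) = 0" for b e
    by (rule sum_skew_eq_0[OF C(1) l3 _ skew]) (simp add: C)
  \<comment> \<open>The sum is the squared norm of \<open>\<phi>\<close> in the chosen bases;
    \<open>eigen\<close> turns \<open>c\<close> times it into pairings of \<open>\<phi>\<close> with
    its image under \<open>A\<close>, one per slot, which vanish.\<close>
  have "c * (\<Sum>b\<in>B. \<Sum>e\<in>C. \<Sum>f\<in>C. (\<phi> b e f)\<^sup>2)
      = (\<Sum>b\<in>B. \<Sum>e\<in>C. \<Sum>f\<in>C. \<phi> b e f * (c * \<phi> b e f))"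
    by (simp add: sum_distrib_left power2_eq_square algebra_simps)
  also have "\<dots> = - ((\<Sum>b\<in>B. \<Sum>e\<in>C. \<Sum>f\<in>C. \<phi> b e f * \<phi> (A b) e f)
      + (\<Sum>b\<in>B. \<Sum>e\<in>C. \<Sum>f\<in>C. \<phi> b e f * \<phi> b (A e) f)
      + (\<Sum>b\<in>B. \<Sum>e\<in>C. \<Sum>f\<in>C. \<phi> b e f * \<phi> b e (A f)))"
    by (simp add: eigen Bu sum.distrib sum_negf sum_subtractf distrib_left right_diff_distrib)
  also have "(\<Sum>b\<in>B. \<Sum>e\<in>C. \<Sum>f\<in>C. \<phi> b e f * \<phi> (A b) e f)
      = (\<Sum>e\<in>C. \<Sum>f\<in>C. \<Sum>b\<in>B. \<phi> b e f * \<phi> (A b) e f)"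
    by (subst sum.swap, intro sum.cong refl sum.swap)
  also have "\<dots> = 0" by (simp add: 1)
  also have "(\<Sum>b\<in>B. \<Sum>e\<in>C. \<Sum>f\<in>C. \<phi> b e f * \<phi> b (A e) f)
      = (\<Sum>b\<in>B. \<Sum>f\<in>C. \<Sum>e\<in>C. \<phi> b e f * \<phi> b (A e) f)"
    by (intro sum.cong refl sum.swap)
  also have "\<dots> = 0" by (simp add: 2)
  finally have "(\<Sum>b\<in>B. \<Sum>e\<in>C. \<Sum>f\<in>C. (\<phi> b e f)\<^sup>2) = 0"
    using \<open>c \<noteq> 0\<close> by (simp add: 3)
  then have 0: "\<phi> b e f = 0" if "b \<in> B" "e \<in> C" "f \<in> C" for b e f
    using that fin by (simp add: sum_nonneg_eq_0_iff sum_nonneg)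
  have zero: "h x = 0" if "linear h" "\<And>b. b \<in> E \<Longrightarrow> h b = 0" "x \<in> span E" for h :: "'a \<Rightarrow> real" and E x
    using linear_eq_0_on_span[OF that(1)] that(2,3) by blast
  have "\<phi> b e z = 0" if "b \<in> B" "e \<in> C" for b e
    by (rule zero[OF l3, of C]) (use 0 that C in auto)
  then have "\<phi> b y z = 0" if "b \<in> B" for b
    by - (rule zero[OF l2, of C], use that C in auto)
  then show ?thesis
    by - (rule zero[OF l1, of B], use \<open>v \<in> u\<close> B in auto)
qed

end

section \<open>The Weyl connection of a closed form\<close>

locale closed_weyl = inner_product_space g
  for g :: "'a::real_vector \<Rightarrow> 'a \<Rightarrow> real" +
  fixes br :: "'a \<Rightarrow> 'a \<Rightarrow> 'a" and \<theta> :: "'a \<Rightarrow> real"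
  assumes lie: "lie_algebra br"
    and fd: "finite_dimensional TYPE('a)"
    and closed: "closed_form br \<theta>"
begin

abbreviation D :: "'a \<Rightarrow> 'a \<Rightarrow> 'a" where
  "D \<equiv> weyl br g \<theta>"

definition R :: "'a \<Rightarrow> 'a \<Rightarrow> 'a \<Rightarrow> 'a" where
  "R x y z = D x (D y z) - D y (D x z) - D (br x y) z"

lemma bilinear_br: "bilinear br"
  using lie by (simp add: lie_algebra_def)

lemmas br_simps =
  bilinear_ladd[OF bilinear_br] bilinear_radd[OF bilinear_br]
  bilinear_lmul[OF bilinear_br] bilinear_rmul[OF bilinear_br]

lemma br_skew: "br x y = - br y x"
proof -
  have self: "br z z = 0" for z using lie by (simp add: lie_algebra_def)
  have "br (x + y) (x + y) = br x x + br y x + (br x y + br y y)" by (simp only: br_simps)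
  then have "br x y + br y x = 0" by (simp add: self add.commute)
  then show ?thesis by (simp add: eq_neg_iff_add_eq_0)
qed

lemma jacobi: "br x (br y z) + br y (br z x) + br z (br x y) = 0"
  using lie by (simp add: lie_algebra_def)

lemma linear_theta: "linear \<theta>"
  using closed by (simp add: closed_form_def)

lemma theta_br: "\<theta> (br x y) = 0"
proof -
  have "br x y \<in> derived_algebra br"
    unfolding derived_algebra_def by (rule span_base) blast
  then show ?thesis using closed by (simp add: closed_form_def)
qed

lemma g_sharp: "g (sharp g \<theta>) z = \<theta> z"
  by (rule sharp_eq[OF fd inner_product linear_theta])

text \<open>Pairing with \<open>z\<close> makes both \<open>THE\<close> vectors explicit, so
  identities for \<open>D\<close> reduce to algebra through \<open>g_eqI\<close>.\<close>

lemma g_weyl: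
  "g (D x y) z = 1/2 * (g (br x y) z - g (br x z) y - g (br y z) x)
     + \<theta> x * g y z + \<theta> y * g x z - g x y * \<theta> z"
  by (simp add: weyl_def g_simps g_sharp levi_civita_eq[OF fd inner_product bilinear_br])

lemma bilinear_weyl: "bilinear D"
  unfolding bilinear_def
  by (intro conjI allI linearI; rule g_eqI;
      simp add: g_weyl g_simps br_simps linear_add[OF linear_theta] linear_scale[OF linear_theta]
        field_simps)

lemmas D_simps =
  bilinear_ladd[OF bilinear_weyl] bilinear_radd[OF bilinear_weyl]
  bilinear_lmul[OF bilinear_weyl] bilinear_rmul[OF bilinear_weyl]
  bilinear_lsub[OF bilinear_weyl] bilinear_rsub[OF bilinear_weyl]
  bilinear_lneg[OF bilinear_weyl] bilinear_rneg[OF bilinear_weyl]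

lemma weyl_torsion_free: "D x y - D y x = br x y"
proof (rule g_eqI)
  fix z
  show "g (D x y - D y x) z = g (br x y) z"
    using br_skew[of y x] g_commute[of x y] by (simp add: g_simps g_weyl field_simps)
qed

text \<open>Only the term \<open>\<theta> x *\<^sub>R y\<close> of \<open>D x y\<close> fails to be
  skew in \<open>y\<close>: the Levi-Civita part is skew, and so are the last two terms
  together.\<close>

lemma weyl_conformal: "g (D x y) z = 2 * \<theta> x * g y z - g y (D x z)"
  using br_skew[of z y] g_commute[of z y] g_commute[of y "D x z"] g_commute[of x z]
    g_commute[of x y]
  by (simp add: g_simps g_weyl field_simps)

section \<open>Curvature identities\<close>

lemma bianchi: "R x y z + R y z x + R z x y = 0"
proof -
  have *: "D x (br y z) - D (br y z) x = br x (br y z)" for x y z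
    by (rule weyl_torsion_free)
  \<comment> \<open>Grouped by the outer map, so that torsion-freeness applies first inside, then
    outside, and leaves the Jacobi sum.\<close>
  have "R x y z + R y z x + R z x y =
     (D x (D y z - D z y) - D (br y z) x) + (D y (D z x - D x z) - D (br z x) y)
     + (D z (D x y - D y x) - D (br x y) z)"
    by (simp add: R_def D_simps)
  then show ?thesis unfolding weyl_torsion_free * jacobi .
qed

lemma R_antisym: "R x y z = - R y x z"
  using br_skew[of x y] by (simp add: R_def D_simps)

text \<open>Commutators of maps of the form scalar plus skew are skew, and \<open>theta_br\<close>
  removes the scalar part of \<open>D (br x y)\<close>.\<close>

lemma R_skew: "g (R x y z) w = - g z (R x y w)"
proof -
  have *: "g (D x (D y z)) w
      = 2 * \<theta> x * g (D y z) w - 2 * \<theta> y * g z (D x w) + g z (D y (D x w))" for x y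
    using weyl_conformal[of x "D y z" w] weyl_conformal[of y z "D x w"] by simp
  have **: "2 * \<theta> x * g (D y z) w + 2 * \<theta> x * g z (D y w) = 4 * (\<theta> x * \<theta> y * g z w)" for x y
    unfolding weyl_conformal[of y z w] by (simp add: algebra_simps)
  have "g (D (br x y) z) w = - g z (D (br x y) w)"
    using weyl_conformal[of "br x y" z w] by (simp add: theta_br)
  then show ?thesis
    unfolding R_def g_simps * using **[of x y] **[of y x] mult.commute[of "\<theta> x" "\<theta> y"] by simp
qed

lemma R_eq_0:
  assumes "\<And>x y. R x y v = 0"
  shows "R v x y = 0"
proof (rule g_eqI)
  have sym: "R v x y = R v y x" for x y
    using bianchi[of v x y] assms[of x y] R_antisym[of y v x] by simp
  have s: "g (R v x y) z = g (R v y x) z" for x y z using sym by simp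
  have t: "g (R v x y) z = - g (R v x z) y" for x y z
    using R_skew[of v x y z] g_commute by simp
  fix z
  \<comment> \<open>Alternating \<open>t\<close> and \<open>s\<close> runs through all six orderings
    of \<open>x\<close>, \<open>y\<close>, \<open>z\<close> and changes the sign three
    times.\<close>
  have "g (R v x y) z = - g (R v x y) z"
    using t[of x y z] s[of x z y] t[of z x y] s[of z y x] t[of y z x] s[of y x z] by linarith
  then show "g (R v x y) z = g 0 z" by (simp add: g_simps)
qed

end

section \<open>Adapted LCP structures\<close>

locale adapted_lcp = closed_weyl g br \<theta>
  for g :: "'a::real_vector \<Rightarrow> 'a \<Rightarrow> real" and br \<theta> +
  fixes u :: "'a set"
  assumes theta_nz: "\<theta> \<noteq> (\<lambda>_. 0)"
    and weyl_flat: "weyl_flat br g \<theta> u"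
    and theta_u: "v \<in> u \<Longrightarrow> \<theta> v = 0"
begin

abbreviation \<xi> :: 'a where
  "\<xi> \<equiv> sharp g \<theta>"

lemma subspace_u: "subspace u"
  using weyl_flat by (simp add: weyl_flat_def)

lemma weyl_in_u: "v \<in> u \<Longrightarrow> D x v \<in> u"
  using weyl_flat by (auto simp: weyl_flat_def)

lemma R_u: "v \<in> u \<Longrightarrow> R x y v = 0"
  using weyl_flat by (simp add: weyl_flat_def lie_representation_on_def R_def)

lemma theta_xi: "\<theta> \<xi> \<noteq> 0"
proof
  assume "\<theta> \<xi> = 0"
  then have "\<xi> = 0" using g_sharp[of \<xi>] g_self_eq_0_iff by simp
  then have "\<theta> z = 0" for z using g_sharp[of z] by (simp add: g_simps)
  then show False using theta_nz by blast
qed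

text \<open>Pairing with \<open>z\<close> leaves \<open>- \<theta> (D v z)\<close>. Up to a bracket,
  which \<open>\<theta>\<close> kills, \<open>D v z\<close> is \<open>D z v\<close>, an element of
  \<open>u\<close>; there adaptedness applies.\<close>

lemma weyl_u_xi:
  assumes "v \<in> u"
  shows "D v \<xi> = 0"
proof (rule g_eqI)
  fix z
  have "D v z = D z v + br v z" using weyl_torsion_free[of v z] by (simp add: algebra_simps)
  then have "\<theta> (D v z) = 0"
    using theta_u[OF weyl_in_u[OF assms]] by (simp add: linear_add[OF linear_theta] theta_br)
  then show "g (D v \<xi>) z = g 0 z"
    using weyl_conformal[of v \<xi> z] theta_u[OF assms] by (simp add: g_sharp g_simps)
qed

lemma weyl_u_eq_0:
  assumes "v \<in> u"
  shows "D v y = 0"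
proof (rule g_eqI)
  define c where "c = \<theta> \<xi>"
  \<comment> \<open>Removing the scalar part \<open>c\<close> of \<open>D \<xi>\<close> makes
    \<open>A\<close> skew.\<close>
  define A where "A x = D \<xi> x - c *\<^sub>R x" for x
  fix z
  have "g (D v y) z = 0"
  proof (rule trilinear_eigen_eq_0[where \<phi> = "\<lambda>v y z. g (D v y) z" and A = A, OF fd subspace_u])
    show "linear (\<lambda>v. g (D v y) z)" for y z
      by (rule linearI) (simp_all add: g_simps D_simps)
    show "linear (\<lambda>y. g (D v y) z)" for v z
      by (rule linearI) (simp_all add: g_simps D_simps)
    show "linear (\<lambda>z. g (D v y) z)" for v y
      by (rule linearI) (simp_all add: g_simps)
    show "g (A x) y = - g x (A y)" for x y
      using weyl_conformal[of \<xi> x y] by (simp add: A_def g_simps c_def)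
    show "A v \<in> u" if "v \<in> u" for v
      unfolding A_def using that by (intro subspace_diff subspace_scale subspace_u weyl_in_u)
    show "c \<noteq> 0" using theta_xi by (simp add: c_def)
    show "c * g (D v y) z = - (g (D (A v) y) z + g (D v (A y)) z + g (D v y) (A z))"
      if v: "v \<in> u" for v y z
    proof -
      have "br \<xi> v = D \<xi> v" using weyl_torsion_free[of \<xi> v] weyl_u_xi[OF v] by simp
      then have "D (D \<xi> v) y = D \<xi> (D v y) - D v (D \<xi> y)"
        using R_eq_0[OF R_u[OF v], of \<xi> y] R_antisym[of v \<xi> y] by (simp add: R_def)
      then have "g (D (D \<xi> v) y) z
          = 2 * c * g (D v y) z - g (D v y) (D \<xi> z) - g (D v (D \<xi> y)) z"
        using weyl_conformal[of \<xi> "D v y" z] by (simp add: g_simps c_def)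
      \<comment> \<open>The three slots shift by \<open>- c\<close> each; against the conformal term
        \<open>2 * c\<close> this leaves the eigenvalue \<open>- c\<close>.\<close>
      then show ?thesis by (simp add: A_def g_simps D_simps)
    qed
  qed fact
  then show "g (D v y) z = g 0 z" by (simp add: g_simps)
qed

section \<open>Structure of \<open>u\<close> and of its orthogonal complement\<close>

lemma br_eq_weyl:
  assumes "v \<in> u"
  shows "br x v = D x v"
  using weyl_torsion_free[of x v] weyl_u_eq_0[OF assms] by simp

lemma lie_ideal_u: "lie_ideal br u"
  by (simp add: lie_ideal_def subspace_u br_eq_weyl weyl_in_u)

lemma abelian_u: "abelian_on br u"
  by (simp add: abelian_on_def br_eq_weyl weyl_u_eq_0)

text \<open>Since \<open>D x\<close> preserves \<open>u\<close>, \<open>weyl_conformal\<close> shows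
  that it preserves the complement too; brackets are differences of such values.\<close>

lemma lie_subalgebra_orth_compl: "lie_subalgebra br (orth_compl g u)"
  unfolding lie_subalgebra_def
proof (intro conjI ballI)
  show "subspace (orth_compl g u)"
    by (simp add: orth_compl_def subspace_def g_simps)
  fix x y assume xy: "x \<in> orth_compl g u" "y \<in> orth_compl g u"
  then have "g (br x y) v = 0" if "v \<in> u" for v
    using weyl_conformal[of x y v] weyl_conformal[of y x v] that weyl_in_u[OF that]
    by (simp add: orth_compl_def g_simps weyl_torsion_free[symmetric])
  then show "br x y \<in> orth_compl g u" by (simp add: orth_compl_def)
qed

text \<open>On the diagonal the skew part of \<open>D x\<close> drops out.\<close>

lemma g_br_self:
  assumes "v \<in> u"
  shows "g (br x v) v = \<theta> x * g v v"
  using weyl_conformal[of x v v] g_commute[of v "D x v"] br_eq_weyl[OF assms] by simp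

text \<open>
  By \<open>g_br_self\<close> for \<open>x = \<xi>\<close>, no nonzero vector of \<open>u\<close> is orthogonal to \<open>[\<xi>,u]\<close>.
\<close>

lemma u_subset_derived: "u \<subseteq> derived_algebra br"
proof
  fix v assume v: "v \<in> u"
  have lin: "linear (br \<xi>)" using bilinear_br by (simp add: bilinear_def)
  have "subspace (br \<xi> ` u)" by (rule linear_subspace_image[OF lin subspace_u])
  then obtain B where B: "orthonormal g B" "span B = br \<xi> ` u"
    using orthonormal_basis_of_subspace[OF fd] by blast
  define p where "p = (\<Sum>b\<in>B. g v b *\<^sub>R b)"
  have p: "p \<in> br \<xi> ` u"
    unfolding B(2)[symmetric] p_def by (intro span_sum span_scale span_base)
  then have "p \<in> u" using lie_ideal_u by (auto simp: lie_ideal_def)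
  then have w: "v - p \<in> u" using v subspace_u by (simp add: subspace_diff)
  have orth: "g (v - p) b = 0" if "b \<in> B" for b
    using orthonormal_coeff[OF B(1) that, of "g v"] by (simp add: p_def g_simps)
  have "br \<xi> (v - p) \<in> span B" using B(2) w by simp
  \<comment> \<open>The remainder is orthogonal to the whole image of \<open>u\<close>, in
    particular to its own image.\<close>
  then have "g (br \<xi> (v - p)) (v - p) = 0"
    by (rule linear_eq_0_on_span[OF linear_g, rotated]) (use orth g_commute[of _ "v - p"] in simp)
  then have "v - p = 0" using g_br_self[OF w, of \<xi>] theta_xi g_self_eq_0_iff by simp
  moreover have "br \<xi> ` u \<subseteq> derived_algebra br"
    unfolding derived_algebra_def by (auto intro!: span_base)
  ultimately show "v \<in> derived_algebra br" using p by auto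
qed

text \<open>The trace may be computed in an orthonormal basis of \<open>u\<close>, where
  \<open>g_br_self\<close> makes every diagonal entry \<open>\<theta> x\<close>.\<close>

lemma trace_br: "trace_on u (br x) = \<theta> x * real (dim u)"
proof -
  obtain B where B: "orthonormal g B" "span B = u"
    using orthonormal_basis_of_subspace[OF fd subspace_u] by blast
  have Bu: "b \<in> u" if "b \<in> B" for b using B(2) that by (auto intro: span_base)
  have ind: "independent B" by (rule orthonormal_independent[OF B(1)])
  have lin: "linear (br x)" using bilinear_br by (simp add: bilinear_def)
  have inv: "br x ` u \<subseteq> u" using lie_ideal_u by (auto simp: lie_ideal_def)
  have "trace_on u (br x) = (\<Sum>b\<in>B. representation B (br x b) b)"
    by (rule trace_on_eq[OF fd ind B(2) lin inv])
  also have "\<dots> = (\<Sum>b\<in>B. \<theta> x)"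
  proof (rule sum.cong[OF refl])
    fix b assume b: "b \<in> B"
    then have "br x b \<in> span B" using inv Bu B(2) by blast
    then have "representation B (br x b) b = g (br x b) b"
      by (rule representation_orthonormal[OF B(1) _ b])
    also have "\<dots> = \<theta> x" using g_br_self[OF Bu[OF b]] B(1) b by (simp add: orthonormal_def)
    finally show "representation B (br x b) b = \<theta> x" .
  qed
  also have "\<dots> = \<theta> x * real (dim u)"
    using real_vector.dim_span_eq_card_independent[OF ind] B(2) by (simp add: mult.commute)
  finally show ?thesis .
qed

text \<open>Allows \<open>trace_br\<close> to be solved for \<open>\<theta> x\<close>.\<close>

lemma dim_u_nonzero:
  assumes "u \<noteq> {0}"
  shows "dim u \<noteq> 0"
proof
  assume d: "dim u = 0"
  obtain B where B: "orthonormal g B" "span B = u"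
    using orthonormal_basis_of_subspace[OF fd subspace_u] by blast
  have "card B = 0"
    using real_vector.dim_span_eq_card_independent[OF orthonormal_independent[OF B(1)]] B(2) d by simp
  then have "B = {}" using B(1) by (simp add: orthonormal_def)
  then show False using B(2) assms by simp
qed

end

theorem theorem4p9:
  fixes br :: "'a::real_vector \<Rightarrow> 'a \<Rightarrow> 'a"
    and g :: "'a \<Rightarrow> 'a \<Rightarrow> real"
    and \<theta> :: "'a \<Rightarrow> real"
    and u :: "'a set"
  assumes "lie_algebra br"
    and "finite_dimensional TYPE('a)"
    and "adapted_lcp_structure br g \<theta> u"
  shows "lie_ideal br u \<and> abelian_on br u \<and> u \<subseteq> derived_algebra br \<and>
    lie_subalgebra br (orth_compl g u) \<and>
    (\<forall>x. (\<forall>y\<in>u. br x y = weyl br g \<theta> x y) \<and>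
         \<theta> x = 1 / real (dim u) * trace_on u (br x))"
proof -
  interpret adapted_lcp g br \<theta> u
    by unfold_locales
      (use assms in \<open>auto simp: adapted_lcp_structure_def lcp_structure_def\<close>)
  have "dim u \<noteq> 0"
    using assms(3) by (intro dim_u_nonzero) (simp add: adapted_lcp_structure_def lcp_structure_def)
  then show ?thesis
    using lie_ideal_u abelian_u u_subset_derived lie_subalgebra_orth_compl br_eq_weyl trace_br
    by simp
qed

end
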